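(* Let $\tau : \mathbb{M}_d \to \mathbb{M}_d$ be a unital completely positive (UCP) map. Then $\tau$ is peripherally automorphic if and only if $\mathcal{P}(\tau)$ is closed under matrix multiplication. In this case, $X \mapsto \tau(X)$ is a $C^*$-algebra automorphism of $\mathcal{P}(\tau)$.
   Context: $\mathbb{M}_d$ is the $C^*$-algebra of $d\times d$ complex matrices and $\mathbb{T} = \{z \in \mathbb{C} : |z| = 1\}$. For a UCP map $\tau$ on $\mathbb{M}_d$ and $\lambda\in\mathbb{C}$, $E_\lambda(\tau) := \{X \in \mathbb{M}_d : \tau(X) = \lambda X\}$. The peripheral space of $\tau$ is $\mathcal{P}(\tau) := \mathrm{span}\{X \in \mathbb{M}_d : \tau(X) = \lambda X \text{ for some } \lambda \in \mathbb{T}\}$. The product $\circ$ on $\mathcal{P}(\tau)$ is the bilinear product determined by $X \circ Y = \lim_{n\to\infty} (\lambda\mu)^{-n}\tau^n(XY)$ for $X \in E_\lambda(\tau)$, $Y \in E_\mu(\tau)$, $\lambda,\mu\in\mathbb{T}$ (it is known that these limits exist, that the product is well defined, and that $(\mathcal{P}(\tau),\circ)$ with the norm and adjoint of $\mathbb{M}_d$ is a $C^*$-algebra). The map $\tau$ is called peripherally automorphic if $X \circ Y = XY$ for all $X, Y \in \mathcal{P}(\tau)$; in that case $\mathcal{P}(\tau)$ is regarded as a $C^*$-algebra with the usual matrix product. *)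

theory Defs
  imports "HOL-Analysis.Analysis"
begin

text \<open>
  The algebra of \<open>d \<times> d\<close> complex matrices is the type \<open>complex^'d^'d\<close>, with \<open>CARD('d) = d\<close>
  arbitrary. Its library norm is the Euclidean (Hilbert-Schmidt) one rather than the
  operator norm; only the topology is used below, and the two norms induce the same topology.
\<close>

type_synonym 'd cmat = "complex ^ 'd ^ 'd"

definition cscale :: "complex \<Rightarrow> 'd::finite cmat \<Rightarrow> 'd cmat" where
  "cscale c A = (\<chi> i j. c * A $ i $ j)"

interpretation cmat: vector_space "cscale :: complex \<Rightarrow> 'd::finite cmat \<Rightarrow> 'd cmat"
  by unfold_locales (auto simp: cscale_def vec_eq_iff algebra_simps)

definition cadjoint :: "'d::finite cmat \<Rightarrow> 'd cmat" where
  "cadjoint A = (\<chi> i j. cnj (A $ j $ i))"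

definition cinner :: "complex ^ 'd::finite \<Rightarrow> complex ^ 'd \<Rightarrow> complex" where
  "cinner x y = (\<Sum>i\<in>UNIV. x $ i * cnj (y $ i))"

text \<open>
  An element of the algebra of \<open>k \<times> k\<close> matrices over \<open>complex^'d^'d\<close> is given by its blocks
  \<open>B i j\<close> with \<open>i, j < k\<close> (other values of \<open>B\<close> are ignored). It acts on the \<open>k\<close>-fold direct sum
  of \<open>complex^'d\<close>; positivity is positivity of this operator.
\<close>

definition block_positive :: "nat \<Rightarrow> (nat \<Rightarrow> nat \<Rightarrow> 'd::finite cmat) \<Rightarrow> bool" where
  "block_positive k B \<longleftrightarrow>
     (\<forall>x :: nat \<Rightarrow> complex ^ 'd.
        (\<Sum>i<k. cinner (\<Sum>j<k. B i j *v x j) (x i)) \<in> \<real>\<^sub>\<ge>\<^sub>0)"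

definition completely_positive :: "('d::finite cmat \<Rightarrow> 'd cmat) \<Rightarrow> bool" where
  "completely_positive \<tau> \<longleftrightarrow>
     Vector_Spaces.linear cscale cscale \<tau> \<and>
     (\<forall>k B. block_positive k B \<longrightarrow> block_positive k (\<lambda>i j. \<tau> (B i j)))"

definition ucp :: "('d::finite cmat \<Rightarrow> 'd cmat) \<Rightarrow> bool" where
  "ucp \<tau> \<longleftrightarrow> completely_positive \<tau> \<and> \<tau> (mat 1) = mat 1"

definition eigenspace :: "('d::finite cmat \<Rightarrow> 'd cmat) \<Rightarrow> complex \<Rightarrow> 'd cmat set" where
  "eigenspace \<tau> \<alpha> = {X. \<tau> X = cscale \<alpha> X}"

definition peripheral_space :: "('d::finite cmat \<Rightarrow> 'd cmat) \<Rightarrow> 'd cmat set" where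
  "peripheral_space \<tau> = cmat.span {X. \<exists>\<alpha>. norm \<alpha> = 1 \<and> \<tau> X = cscale \<alpha> X}"

definition is_peripheral_product ::
  "('d::finite cmat \<Rightarrow> 'd cmat) \<Rightarrow> ('d cmat \<Rightarrow> 'd cmat \<Rightarrow> 'd cmat) \<Rightarrow> bool" where
  "is_peripheral_product \<tau> m \<longleftrightarrow>
     (\<forall>X\<in>peripheral_space \<tau>. \<forall>Y\<in>peripheral_space \<tau>. m X Y \<in> peripheral_space \<tau>) \<and>
     (\<forall>X\<in>peripheral_space \<tau>. \<forall>Y\<in>peripheral_space \<tau>. \<forall>Z\<in>peripheral_space \<tau>.
        m (X + Y) Z = m X Z + m Y Z \<and> m X (Y + Z) = m X Y + m X Z) \<and>
     (\<forall>c. \<forall>X\<in>peripheral_space \<tau>. \<forall>Y\<in>peripheral_space \<tau>.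
        m (cscale c X) Y = cscale c (m X Y) \<and> m X (cscale c Y) = cscale c (m X Y)) \<and>
     (\<forall>\<alpha> \<beta>. norm \<alpha> = 1 \<longrightarrow> norm \<beta> = 1 \<longrightarrow>
        (\<forall>X\<in>eigenspace \<tau> \<alpha>. \<forall>Y\<in>eigenspace \<tau> \<beta>.
           (\<lambda>n. cscale (inverse (\<alpha> * \<beta>) ^ n) ((\<tau> ^^ n) (X ** Y))) \<longlonglongrightarrow> m X Y))"

lemma is_peripheral_product_unique:
  assumes m: "is_peripheral_product \<tau> m" and m': "is_peripheral_product \<tau> m'"
    and X: "X \<in> peripheral_space \<tau>" and Y: "Y \<in> peripheral_space \<tau>"
  shows "m X Y = m' X Y"
proof -
  let ?P = "peripheral_space \<tau>" and ?E = "{X. \<exists>\<alpha>. norm \<alpha> = 1 \<and> \<tau> X = cscale \<alpha> X}"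
  have base: "m U V = m' U V" if "U \<in> ?E" "V \<in> ?E" for U V
  proof -
    from that obtain \<alpha> \<beta> where *: "norm \<alpha> = 1" "norm \<beta> = 1"
      "U \<in> eigenspace \<tau> \<alpha>" "V \<in> eigenspace \<tau> \<beta>"
      by (auto simp: eigenspace_def)
    show ?thesis
      using m m' * unfolding is_peripheral_product_def by (meson LIMSEQ_unique)
  qed
  have subE: "U \<in> ?P" if "U \<in> ?E" for U
    using that unfolding peripheral_space_def by (rule cmat.span_base)
  have zero: "0 \<in> ?P" unfolding peripheral_space_def by (rule cmat.span_zero)
  have add: "U + V \<in> ?P" if "U \<in> ?P" "V \<in> ?P" for U V
    using that unfolding peripheral_space_def by (rule cmat.span_add)
  have scale: "cscale c U \<in> ?P" if "U \<in> ?P" for c U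
    using that unfolding peripheral_space_def by (rule cmat.span_scale)
  have addL: "k (U + V) W = k U W + k V W" and addR: "k W (U + V) = k W U + k W V"
    and scaleL: "k (cscale c U) W = cscale c (k U W)"
    and scaleR: "k W (cscale c U) = cscale c (k W U)"
    if "k = m \<or> k = m'" "U \<in> ?P" "V \<in> ?P" "W \<in> ?P" for k U V W c
    using that m m' unfolding is_peripheral_product_def by auto
  have zeroR: "m U 0 = m' U 0" and zeroL: "m 0 U = m' 0 U" if "U \<in> ?P" for U
  proof -
    have "m U (0 + 0) = m U 0 + m U 0" "m' U (0 + 0) = m' U 0 + m' U 0"
      "m (0 + 0) U = m 0 U + m 0 U" "m' (0 + 0) U = m' 0 U + m' 0 U"
      by (rule addL addR; use that zero in simp)+
    then show "m U 0 = m' U 0" "m 0 U = m' 0 U" by simp_all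
  qed
  have right: "V \<in> ?P \<and> m U V = m' U V" if U: "U \<in> ?E" and V: "V \<in> ?P" for U V
    using V[unfolded peripheral_space_def]
  proof (induction rule: cmat.span_induct_alt)
    case base
    show ?case using zero zeroR[OF subE[OF U]] by simp
  next
    case (step c x y)
    have x: "cscale c x \<in> ?P" "x \<in> ?P" using step(1) scale subE by blast+
    have "m U (cscale c x + y) = cscale c (m U x) + m U y"
      "m' U (cscale c x + y) = cscale c (m' U x) + m' U y"
      using x subE[OF U] step(2) by (simp_all add: addR scaleR[where V = x])
    then show ?case using add[OF x(1)] step base[OF U] by simp
  qed
  have "X \<in> ?P \<and> m X Y = m' X Y"
    using X[unfolded peripheral_space_def]
  proof (induction rule: cmat.span_induct_alt)
    case base
    show ?case using zero zeroL[OF Y] by simp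
  next
    case (step c x y)
    have x: "cscale c x \<in> ?P" "x \<in> ?P" using step(1) scale subE by blast+
    have "m (cscale c x + y) Y = cscale c (m x Y) + m y Y"
      "m' (cscale c x + y) Y = cscale c (m' x Y) + m' y Y"
      using x Y step(2) by (simp_all add: addL scaleL[where V = x])
    then show ?case using add[OF x(1)] step right[OF step(1) Y] by simp
  qed
  then show ?thesis ..
qed

text \<open>
  For a UCP map such a product exists; by the lemma above its values on the peripheral
  space do not depend on the choice. Only these values are ever used.
\<close>

definition peripheral_product ::
  "('d::finite cmat \<Rightarrow> 'd cmat) \<Rightarrow> 'd cmat \<Rightarrow> 'd cmat \<Rightarrow> 'd cmat" where
  "peripheral_product \<tau> = (SOME m. is_peripheral_product \<tau> m)"

definition peripherally_automorphic :: "('d::finite cmat \<Rightarrow> 'd cmat) \<Rightarrow> bool" where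
  "peripherally_automorphic \<tau> \<longleftrightarrow>
     (\<forall>X\<in>peripheral_space \<tau>. \<forall>Y\<in>peripheral_space \<tau>. peripheral_product \<tau> X Y = X ** Y)"

definition cstar_subalgebra :: "'d::finite cmat set \<Rightarrow> bool" where
  "cstar_subalgebra S \<longleftrightarrow>
     cmat.subspace S \<and> closed S \<and>
     (\<forall>X\<in>S. \<forall>Y\<in>S. X ** Y \<in> S) \<and> (\<forall>X\<in>S. cadjoint X \<in> S)"

definition cstar_automorphism_on ::
  "'d::finite cmat set \<Rightarrow> ('d cmat \<Rightarrow> 'd cmat) \<Rightarrow> bool" where
  "cstar_automorphism_on S f \<longleftrightarrow>
     bij_betw f S S \<and>
     (\<forall>X\<in>S. \<forall>Y\<in>S. f (X + Y) = f X + f Y) \<and>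
     (\<forall>c. \<forall>X\<in>S. f (cscale c X) = cscale c (f X)) \<and>
     (\<forall>X\<in>S. \<forall>Y\<in>S. f (X ** Y) = f X ** f Y) \<and>
     (\<forall>X\<in>S. f (cadjoint X) = cadjoint (f X))"

end

theory Submission
  imports Defs "HOL-Computational_Algebra.Fundamental_Theorem_Algebra"
begin

text \<open>
  By the Kadison--Schwarz inequality a UCP map \<open>\<tau>\<close> is a contraction, so its powers are bounded. Hence the
  matrix algebra splits as \<open>P \<oplus> N\<close>, where \<open>P\<close> is the peripheral space and the powers of \<open>\<tau>\<close> tend
  to \<open>0\<close> on \<open>N\<close>, and some sequence of powers of \<open>\<tau>\<close> converges to the projection \<open>\<Phi>\<close> onto \<open>P\<close>
  along \<open>N\<close>; in particular \<open>\<Phi>\<close> is positive. The Schwarz inequality for \<open>\<tau>\<close>, together with the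
  fact that \<open>\<tau>\<close> is recurrent on \<open>P\<close>, gives \<open>\<tau> (\<Phi> (X Y)) = \<Phi> (\<tau> X \<tau> Y)\<close> on \<open>P\<close>. So the peripheral
  product is \<open>\<Phi> (X Y)\<close>, which equals \<open>X Y\<close> exactly when \<open>X Y\<close> lies in \<open>P\<close>.
\<close>

section \<open>Complex scalars and positive matrices\<close>

lemma norm_cscale [simp]: "norm (cscale c A) = cmod c * norm A"
proof -
  have "norm (c *s x) = cmod c * norm x" for x :: "complex ^ 'a"
    by (simp add: norm_vec_def L2_set_right_distrib norm_mult)
  moreover have "cscale c A = (\<chi> i. c *s A $ i)"
    by (simp add: cscale_def vec_eq_iff)
  ultimately show ?thesis
    by (simp add: norm_vec_def L2_set_right_distrib)
qed

lemma cscale_of_real: "cscale (of_real r) A = r *\<^sub>R A"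
  by (simp add: cscale_def vec_eq_iff scaleR_conv_of_real[where 'a = complex])

lemma bounded_bilinear_cscale: "bounded_bilinear cscale"
proof
  fix a b :: complex and r :: real and A B :: "'a::finite cmat"
  show "cscale (a + b) A = cscale a A + cscale b A" "cscale a (A + B) = cscale a A + cscale a B"
    by (rule cmat.scale_left_distrib cmat.scale_right_distrib)+
  show "cscale (r *\<^sub>R a) A = r *\<^sub>R cscale a A" "cscale a (r *\<^sub>R A) = r *\<^sub>R cscale a A"
    by (simp_all add: cscale_def vec_eq_iff)
  show "\<exists>K. \<forall>a (A::'a cmat). norm (cscale a A) \<le> norm a * norm A * K"
    by (intro exI[of _ 1]) simp
qed

lemmas tendsto_cscale [tendsto_intros] = bounded_bilinear.tendsto[OF bounded_bilinear_cscale]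

lemma tendsto_matrix_mult [tendsto_intros]:
  fixes A :: "'b \<Rightarrow> 'a::{topological_comm_monoid_add,topological_semigroup_mult,semiring_1} ^ 'm ^ 'n"
  assumes "(A \<longlongrightarrow> A') F" "(B \<longlongrightarrow> B') F"
  shows "((\<lambda>k. A k ** B k) \<longlongrightarrow> A' ** B') F"
  unfolding matrix_matrix_mult_def by (intro tendsto_intros assms)

lemma tendsto_matrix_vector_mult [tendsto_intros]:
  fixes A :: "'b \<Rightarrow> 'a::{topological_comm_monoid_add,topological_semigroup_mult,semiring_1} ^ 'm ^ 'n"
  assumes "(A \<longlongrightarrow> A') F" "(v \<longlongrightarrow> v') F"
  shows "((\<lambda>k. A k *v v k) \<longlongrightarrow> A' *v v') F"
  unfolding matrix_vector_mult_def by (intro tendsto_intros assms)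

lemma tendsto_cinner [tendsto_intros]:
  assumes "(x \<longlongrightarrow> x') F" "(y \<longlongrightarrow> y') F"
  shows "((\<lambda>k. cinner (x k) (y k)) \<longlongrightarrow> cinner x' y') F"
  unfolding cinner_def by (intro tendsto_intros assms)

lemma tendsto_cadjoint [tendsto_intros]:
  assumes "(A \<longlongrightarrow> A') F"
  shows "((\<lambda>k. cadjoint (A k)) \<longlongrightarrow> cadjoint A') F"
  unfolding cadjoint_def by (intro tendsto_intros assms)

lemma matrix_add_rdistrib: "(A + B) ** C = A ** C + B ** (C :: 'a::semiring_1 ^ 'p ^ 'n)"
  by (simp add: matrix_matrix_mult_def vec_eq_iff distrib_right sum.distrib)

lemma cscale_matrix_mult_left: "cscale c A ** B = cscale c (A ** B)"
  by (simp add: cscale_def matrix_matrix_mult_def vec_eq_iff sum_distrib_left mult.assoc)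

lemma cscale_matrix_mult_right: "A ** cscale c B = cscale c (A ** B)"
  by (simp add: cscale_def matrix_matrix_mult_def vec_eq_iff sum_distrib_left mult.left_commute)

lemma cscale_matrix_vector_mult: "cscale c A *v x = c *s (A *v x)"
  by (simp add: cscale_def matrix_vector_mult_def vec_eq_iff sum_distrib_left mult.assoc)

lemma matrix_vector_mult_smult: "A *v (c *s x) = c *s (A *v (x :: complex ^ 'n))"
  by (simp add: matrix_vector_mult_def vec_eq_iff sum_distrib_left mult.left_commute)

lemma cadjoint_add: "cadjoint (A + B) = cadjoint A + cadjoint B"
  by (simp add: cadjoint_def vec_eq_iff)

lemma cadjoint_cscale: "cadjoint (cscale c A) = cscale (cnj c) (cadjoint A)"
  by (simp add: cadjoint_def cscale_def vec_eq_iff)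

lemma cadjoint_cadjoint [simp]: "cadjoint (cadjoint A) = A"
  by (simp add: cadjoint_def vec_eq_iff)

lemma cinner_add_left: "cinner (x + y) z = cinner x z + cinner y z"
  by (simp add: cinner_def algebra_simps sum.distrib)

lemma cinner_add_right: "cinner x (y + z) = cinner x y + cinner x z"
  by (simp add: cinner_def algebra_simps sum.distrib)

lemma cinner_diff_left: "cinner (x - y) z = cinner x z - cinner y z"
  by (simp add: cinner_def algebra_simps sum_subtractf)

lemma cinner_minus_left: "cinner (- x) z = - cinner x z"
  by (simp add: cinner_def sum_negf)

lemma cinner_minus_right: "cinner x (- z) = - cinner x z"
  by (simp add: cinner_def sum_negf)

lemma cinner_smult_left: "cinner (c *s x) y = c * cinner x y"
  by (simp add: cinner_def sum_distrib_left mult.assoc)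

lemma cinner_smult_right: "cinner x (c *s y) = cnj c * cinner x y"
  by (simp add: cinner_def sum_distrib_left mult.left_commute)

lemma cinner_zero [simp]: "cinner 0 y = 0" "cinner x 0 = 0"
  by (simp_all add: cinner_def)

lemma cnj_cinner: "cnj (cinner x y) = cinner y x"
  by (simp add: cinner_def mult.commute)

lemmas cinner_simps = cinner_add_left cinner_add_right cinner_diff_left
  cinner_minus_left cinner_minus_right cinner_smult_left cinner_smult_right

lemma cinner_same: "cinner x x = of_real ((norm x)\<^sup>2)"
proof -
  have "(norm x)\<^sup>2 = (\<Sum>i\<in>UNIV. (cmod (x $ i))\<^sup>2)"
    by (simp add: norm_vec_def L2_set_def sum_nonneg)
  then show ?thesis
    by (simp add: cinner_def complex_norm_square del: of_real_power)
qed

lemma cinner_adjoint_left: "cinner (cadjoint A *v x) y = cinner x (A *v y)"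
proof -
  have "cinner (cadjoint A *v x) y = (\<Sum>i\<in>UNIV. \<Sum>j\<in>UNIV. cnj (A $ j $ i) * x $ j * cnj (y $ i))"
    by (simp add: cinner_def cadjoint_def matrix_vector_mult_def sum_distrib_right)
  also have "\<dots> = (\<Sum>j\<in>UNIV. \<Sum>i\<in>UNIV. cnj (A $ j $ i) * x $ j * cnj (y $ i))"
    by (rule sum.swap)
  also have "\<dots> = cinner x (A *v y)"
    by (simp add: cinner_def matrix_vector_mult_def sum_distrib_left mult_ac)
  finally show ?thesis .
qed

lemma minus_matrix_vector_mult: "(- A) *v x = - (A *v (x :: 'a::ring_1 ^ 'n))"
  by (simp add: matrix_vector_mult_def vec_eq_iff sum_negf)

lemma matrix_eqI_cinner:
  assumes "\<And>u v. cinner (A *v v) u = cinner (B *v v) u"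
  shows "A = B"
proof -
  have "A *v v = B *v v" for v
  proof -
    have "cinner (A *v v - B *v v) (A *v v - B *v v) = 0"
      using assms by (simp add: cinner_diff_left)
    then show ?thesis by (simp add: cinner_same)
  qed
  then show ?thesis by (simp add: matrix_eq)
qed

section \<open>Positive semidefinite matrices\<close>

definition psd :: "'d::finite cmat \<Rightarrow> bool" where
  "psd A \<longleftrightarrow> (\<forall>v. cinner (A *v v) v \<in> \<real>\<^sub>\<ge>\<^sub>0)"

lemma psd_add: "psd A \<Longrightarrow> psd B \<Longrightarrow> psd (A + B)"
  by (simp add: psd_def matrix_vector_mult_add_rdistrib cinner_add_left)

lemma psd_limit:
  assumes "A \<longlonglongrightarrow> A'" "\<And>k. psd (A k)"
  shows "psd A'"
  unfolding psd_def
proof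
  fix v
  have "(\<lambda>k. cinner (A k *v v) v) \<longlonglongrightarrow> cinner (A' *v v) v"
    by (intro tendsto_intros assms)
  then show "cinner (A' *v v) v \<in> \<real>\<^sub>\<ge>\<^sub>0"
    by (rule closed_sequentially[OF closed_nonneg_Reals_complex, rotated])
      (use assms in \<open>simp add: psd_def\<close>)
qed

text \<open>Both signs force the quadratic form to vanish; polarization with \<open>u + v\<close>
  and \<open>u + \<i> *s v\<close> then recovers every matrix coefficient.\<close>

lemma psd_antisym:
  assumes "psd A" "psd (- A)"
  shows "A = 0"
proof (rule matrix_eqI_cinner)
  have 0: "cinner (A *v v) v = 0" for v
    using assms[unfolded psd_def, rule_format, of v]
    by (simp add: complex_nonneg_Reals_iff minus_matrix_vector_mult cinner_minus_left complex_eq_iff)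
  fix u v
  have "cinner (A *v v) u + cinner (A *v u) v = 0"
    using 0[of "u + v"] 0[of u] 0[of v]
    by (simp add: matrix_vector_right_distrib cinner_simps)
  moreover have "\<i> * cinner (A *v v) u - \<i> * cinner (A *v u) v = 0"
    using 0[of "u + \<i> *s v"] 0[of u] 0[of v]
    by (simp add: matrix_vector_right_distrib cinner_simps matrix_vector_mult_smult)
  ultimately show "cinner (A *v v) u = cinner (0 *v v) u"
    by (simp add: add_eq_0_iff complex_eq_iff)
qed

text \<open>The one-block case, through which complete positivity yields positivity of the
  map.\<close>

lemma psd_iff_block_positive: "psd A \<longleftrightarrow> block_positive (Suc 0) (\<lambda>_ _. A)"
  unfolding psd_def block_positive_def by (auto intro: allE[of _ "\<lambda>_. _"])

section \<open>Operator bounds versus the Hilbert-Schmidt norm\<close>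

lemma norm_matrix_vector_mult_le: "norm (A *v x) \<le> norm A * norm (x :: complex ^ 'n)"
  for A :: "complex ^ 'n ^ 'm"
proof -
  have row: "norm ((A *v x) $ i) \<le> norm (A $ i) * norm x" for i
  proof -
    have "norm ((A *v x) $ i) \<le> (\<Sum>j\<in>UNIV. norm (A $ i $ j) * norm (x $ j))"
      unfolding matrix_vector_mult_def by (simp add: sum_norm_le norm_mult)
    also have "\<dots> \<le> norm (A $ i) * norm x"
      using L2_set_mult_ineq[of "\<lambda>j. norm (A $ i $ j)" "\<lambda>j. norm (x $ j)" UNIV]
      by (simp add: norm_vec_def)
    finally show ?thesis .
  qed
  have "norm (A *v x) \<le> L2_set (\<lambda>i. norm (A $ i) * norm x) UNIV"
    unfolding norm_vec_def[of "A *v x"] by (intro L2_set_mono row) auto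
  also have "\<dots> = norm A * norm x"
    by (simp add: norm_vec_def[of A] L2_set_left_distrib)
  finally show ?thesis .
qed

text \<open>Each entry is a coordinate of the image of a basis vector, hence at most
  \<open>c\<close> in modulus, and the norm is at most the sum over all entries.\<close>

lemma norm_matrix_le:
  fixes A :: "'d::finite cmat"
  assumes "\<And>v. norm (A *v v) \<le> c * norm v"
  shows "norm A \<le> (real CARD('d))\<^sup>2 * c"
proof -
  have entry: "norm (A $ i $ j) \<le> c" for i j
  proof -
    have "norm (A $ i $ j) = norm ((A *v axis j 1) $ i)"
      by (simp add: matrix_vector_mult_def axis_def if_distrib cong: if_cong)
    also have "\<dots> \<le> c"
      using Finite_Cartesian_Product.norm_nth_le[of "A *v axis j 1" i] assms[of "axis j 1"] by simp
    finally show ?thesis .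
  qed
  have "norm A \<le> (\<Sum>i\<in>UNIV. norm (A $ i))"
    by (simp add: norm_vec_def[of A] L2_set_le_sum)
  also have "\<dots> \<le> (\<Sum>i\<in>UNIV. \<Sum>j\<in>UNIV. norm (A $ i $ j))"
    by (intro sum_mono) (simp add: norm_vec_def L2_set_le_sum)
  also have "\<dots> \<le> (\<Sum>i\<in>(UNIV::'d set). \<Sum>j\<in>(UNIV::'d set). c)"
    by (intro sum_mono entry)
  finally show ?thesis by (simp add: power2_eq_square)
qed

section \<open>UCP maps are power bounded\<close>

lemma ucp_linear: "ucp \<tau> \<Longrightarrow> Vector_Spaces.linear cscale cscale \<tau>"
  by (simp add: ucp_def completely_positive_def)

lemma ucp_psd: "ucp \<tau> \<Longrightarrow> psd A \<Longrightarrow> psd (\<tau> A)"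
  unfolding ucp_def completely_positive_def psd_iff_block_positive by blast

text \<open>Positivity of the block matrix with rows $(1, X)$ and $(X^*, X^* X)$ and of its image.\<close>

lemma ucp_block_form:
  assumes "ucp \<tau>"
  shows "cinner u u + cinner (\<tau> X *v v) u + cinner (\<tau> (cadjoint X) *v u) v
           + cinner (\<tau> (cadjoint X ** X) *v v) v \<in> \<real>\<^sub>\<ge>\<^sub>0"
proof -
  define B where "B i j = (if i = 0 then if j = 0 then mat 1 else X
      else if j = (0::nat) then cadjoint X else cadjoint X ** X)" for i j :: nat
  have "block_positive 2 B"
    unfolding block_positive_def
  proof
    fix x :: "nat \<Rightarrow> complex ^ 'a"
    have "(\<Sum>i<2. cinner (\<Sum>j<2. B i j *v x j) (x i)) =
        cinner (x 0 + X *v x 1) (x 0 + X *v x 1)"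
      by (simp add: numeral_2_eq_2 B_def cinner_simps cinner_adjoint_left
          matrix_vector_mul_assoc[symmetric])
    then show "(\<Sum>i<2. cinner (\<Sum>j<2. B i j *v x j) (x i)) \<in> \<real>\<^sub>\<ge>\<^sub>0"
      by (simp add: cinner_same complex_nonneg_Reals_iff)
  qed
  then have "block_positive 2 (\<lambda>i j. \<tau> (B i j))"
    using assms by (simp add: ucp_def completely_positive_def)
  from this[unfolded block_positive_def, rule_format, of "\<lambda>i. if i = 0 then u else v"]
  show ?thesis
    using assms by (simp add: numeral_2_eq_2 B_def cinner_simps ucp_def add_ac)
qed

lemma ucp_cadjoint:
  assumes "ucp \<tau>"
  shows "\<tau> (cadjoint X) = cadjoint (\<tau> X)"
proof (rule matrix_eqI_cinner)
  fix u v
  \<comment> \<open>The diagonal terms of the block form are real (for the last one take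
    \<open>u = 0\<close>), so the cross terms have a real sum.\<close>
  have cross: "Im (cinner (\<tau> X *v v) u + cinner (\<tau> (cadjoint X) *v u) v) = 0" for u v
    using ucp_block_form[OF assms, of u X v] ucp_block_form[OF assms, of 0 X v]
    by (simp add: complex_nonneg_Reals_iff cinner_same)
  \<comment> \<open>Replacing \<open>v\<close> by \<open>\<i> *s v\<close> turns the statement about
    imaginary parts into one about real parts.\<close>
  have "cinner (\<tau> (cadjoint X) *v v) u = cnj (cinner (\<tau> X *v u) v)"
    using cross[of u v] cross[of u "\<i> *s v"]
    by (simp add: complex_eq_iff cinner_simps matrix_vector_mult_smult)
  then show "cinner (\<tau> (cadjoint X) *v v) u = cinner (cadjoint (\<tau> X) *v v) u"
    by (simp add: cnj_cinner cinner_adjoint_left)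
qed

lemma ucp_schwarz:
  assumes "ucp \<tau>"
  shows "psd (\<tau> (cadjoint X ** X) - cadjoint (\<tau> X) ** \<tau> X)"
  unfolding psd_def
proof
  fix v
  \<comment> \<open>Completing the square: \<open>u = - (\<tau> X *v v)\<close> minimises the block
    form for fixed \<open>v\<close>, and the minimum is the Schwarz defect at
    \<open>v\<close>.\<close>
  show "cinner ((\<tau> (cadjoint X ** X) - cadjoint (\<tau> X) ** \<tau> X) *v v) v \<in> \<real>\<^sub>\<ge>\<^sub>0"
    using ucp_block_form[OF assms, of "- (\<tau> X *v v)" X v]
    by (simp add: ucp_cadjoint[OF assms] cinner_simps cinner_adjoint_left
        matrix_vector_mult_diff_rdistrib matrix_vector_mul_assoc[symmetric]
        vec.neg add.commute)
qed

text \<open>The quadratic form at \<open>v\<close> is the square of \<open>c * norm v\<close> minus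
  the square of \<open>norm (X *v v)\<close>. Operator bounds thus become positivity statements,
  which \<open>\<tau>\<close> preserves.\<close>

lemma psd_contraction_iff:
  assumes "c \<ge> 0"
  shows "psd (cscale ((of_real c)\<^sup>2) (mat 1) - cadjoint X ** X) \<longleftrightarrow> (\<forall>v. norm (X *v v) \<le> c * norm v)"
proof -
  have "cinner ((cscale ((of_real c)\<^sup>2) (mat 1) - cadjoint X ** X) *v v) v =
      of_real ((c * norm v)\<^sup>2 - (norm (X *v v))\<^sup>2)" for v
    by (simp add: cinner_simps matrix_vector_mult_diff_rdistrib cscale_matrix_vector_mult
        matrix_vector_mul_assoc[symmetric] cinner_adjoint_left cinner_same power_mult_distrib)
  then show ?thesis
    using assms by (simp add: psd_def complex_nonneg_Reals_iff abs_le_square_iff[symmetric])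
qed

text \<open>Unitality preserves the scalar part of the positive matrix in
  \<open>psd_contraction_iff\<close>; adding the Schwarz defect then replaces
  \<open>\<tau> (cadjoint X ** X)\<close> by \<open>cadjoint (\<tau> X) ** \<tau> X\<close>.\<close>

lemma ucp_contraction:
  assumes "ucp \<tau>" "c \<ge> 0" "\<And>v. norm (X *v v) \<le> c * norm v"
  shows "norm (\<tau> X *v v) \<le> c * norm v"
proof -
  interpret Vector_Spaces.linear cscale cscale \<tau>
    by (rule ucp_linear[OF assms(1)])
  let ?C = "cscale ((of_real c)\<^sup>2) (mat 1)"
  have "psd (?C - cadjoint X ** X)"
    using assms by (simp add: psd_contraction_iff)
  then have "psd (?C - \<tau> (cadjoint X ** X))"
    using ucp_psd[OF assms(1)] assms(1) by (fastforce simp: diff scale ucp_def)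
  from psd_add[OF this ucp_schwarz[OF assms(1), of X]] show ?thesis
    using assms(2) by (simp add: psd_contraction_iff)
qed

lemma ucp_power_bounded:
  fixes \<tau> :: "'d::finite cmat \<Rightarrow> 'd cmat"
  assumes "ucp \<tau>"
  shows "norm ((\<tau> ^^ n) X) \<le> (real CARD('d))\<^sup>2 * norm X"
proof (rule norm_matrix_le)
  \<comment> \<open>The induction runs on the operator bound, so the dimension factor is paid once
    and not at every iterate.\<close>
  show "norm ((\<tau> ^^ n) X *v v) \<le> norm X * norm v" for v
    by (induction n arbitrary: v)
      (simp_all add: norm_matrix_vector_mult_le ucp_contraction[OF assms])
qed

section \<open>Peripheral decomposition of power bounded maps\<close>

text \<open>Once \<open>e n\<close> stays below \<open>(1 - r) * (\<epsilon> / 2)\<close>, the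
  excess of \<open>b\<close> over \<open>\<epsilon> / 2\<close> is multiplied by at most
  \<open>r\<close> in each step.\<close>

lemma contraction_recursion_tendsto_0:
  fixes b e :: "nat \<Rightarrow> real"
  assumes "\<And>n. 0 \<le> b n" "\<And>n. b (Suc n) \<le> r * b n + e n" "0 \<le> r" "r < 1" "e \<longlonglongrightarrow> 0"
  shows "b \<longlonglongrightarrow> 0"
proof (rule LIMSEQ_I)
  fix \<epsilon> :: real assume "\<epsilon> > 0"
  then have "(1 - r) * (\<epsilon> / 2) > 0" using assms(4) by simp
  from LIMSEQ_D[OF assms(5) this] obtain N where N: "\<And>n. n \<ge> N \<Longrightarrow> e n \<le> (1 - r) * (\<epsilon> / 2)"
    by (metis abs_le_D1 diff_zero less_imp_le real_norm_def)
  have step: "b (N + k) - \<epsilon> / 2 \<le> r ^ k * b N" for k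
  proof (induction k)
    case 0
    then show ?case using \<open>\<epsilon> > 0\<close> by simp
  next
    case (Suc k)
    have "b (N + Suc k) - \<epsilon> / 2 \<le> r * (b (N + k) - \<epsilon> / 2)"
      using assms(2)[of "N + k"] N[of "N + k"] by (simp add: algebra_simps)
    also have "\<dots> \<le> r * (r ^ k * b N)"
      using Suc assms(3) by (rule mult_left_mono)
    finally show ?case by simp
  qed
  have "(\<lambda>k. r ^ k * b N) \<longlonglongrightarrow> 0 * b N"
    using assms(3,4) by (intro tendsto_intros) simp
  from LIMSEQ_D[OF this, of "\<epsilon> / 2"] \<open>\<epsilon> > 0\<close>
  obtain K where K: "\<And>k. k \<ge> K \<Longrightarrow> \<bar>r ^ k * b N\<bar> < \<epsilon> / 2" by auto
  have "norm (b n - 0) < \<epsilon>" if "n \<ge> N + K" for n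
  proof -
    have "b n - \<epsilon> / 2 \<le> r ^ (n - N) * b N" "\<bar>r ^ (n - N) * b N\<bar> < \<epsilon> / 2"
      using step[of "n - N"] K[of "n - N"] that by simp_all
    then show ?thesis using assms(1)[of n] by simp
  qed
  then show "\<exists>n0. \<forall>n\<ge>n0. norm (b n - 0) < \<epsilon>" by blast
qed

section \<open>Iterates of a complex-linear map on matrices\<close>

locale cmat_endo = Vector_Spaces.linear cscale cscale \<tau>
  for \<tau> :: "'d::finite cmat \<Rightarrow> 'd cmat"
begin

lemma bounded_linear_map: "bounded_linear \<tau>"
  unfolding linear_conv_bounded_linear[symmetric]
  by (rule Real_Vector_Spaces.linearI) (simp_all add: add scale cscale_of_real[symmetric])

lemmas tendsto_map [tendsto_intros] = bounded_linear.tendsto[OF bounded_linear_map]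

lemma pow_add: "(\<tau> ^^ n) (X + Y) = (\<tau> ^^ n) X + (\<tau> ^^ n) Y"
  by (induction n) (simp_all add: add)

lemma pow_scale: "(\<tau> ^^ n) (cscale c X) = cscale c ((\<tau> ^^ n) X)"
  by (induction n) (simp_all add: scale)

lemma pow_diff: "(\<tau> ^^ n) (X - Y) = (\<tau> ^^ n) X - (\<tau> ^^ n) Y"
  by (induction n) (simp_all add: diff)

lemma pow_zero: "(\<tau> ^^ n) 0 = 0"
  by (induction n) simp_all

lemma bounded_linear_pow: "bounded_linear (\<tau> ^^ n)"
  unfolding linear_conv_bounded_linear[symmetric]
  by (rule Real_Vector_Spaces.linearI) (simp_all add: pow_add pow_scale cscale_of_real[symmetric])

lemma eigenvector_power:
  assumes "\<tau> X = cscale \<mu> X"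
  shows "(\<tau> ^^ n) X = cscale (\<mu> ^ n) X"
  by (induction n) (simp_all add: assms scale mult.commute)

section \<open>Polynomials in the map, applied to one matrix\<close>

definition poly_map :: "complex poly \<Rightarrow> 'd cmat \<Rightarrow> 'd cmat" where
  "poly_map p X = (\<Sum>i\<le>degree p. cscale (coeff p i) ((\<tau> ^^ i) X))"

lemma poly_map_altdef:
  assumes "degree p \<le> n"
  shows "poly_map p X = (\<Sum>i\<le>n. cscale (coeff p i) ((\<tau> ^^ i) X))"
  unfolding poly_map_def using assms
  by (intro sum.mono_neutral_left) (auto simp: coeff_eq_0)

lemma poly_map_linear_factor: "poly_map ([:- z, 1:] * q) X = \<tau> (poly_map q X) - cscale z (poly_map q X)"
proof -
  have deg: "degree ([:- z, 1:] * q) \<le> Suc (degree q)"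
    using degree_mult_le[of "[:- z, 1:]" q] by simp
  have c: "coeff ([:- z, 1:] * q) i = coeff (pCons 0 q) i - z * coeff q i" for i
    by (simp add: mult_pCons_left)
  have "poly_map ([:- z, 1:] * q) X =
      (\<Sum>i\<le>Suc (degree q). cscale (coeff (pCons 0 q) i) ((\<tau> ^^ i) X))
      - (\<Sum>i\<le>Suc (degree q). cscale (z * coeff q i) ((\<tau> ^^ i) X))"
    unfolding poly_map_altdef[OF deg] c
    by (simp only: cmat.scale_left_diff_distrib sum_subtractf)
  moreover have "(\<Sum>i\<le>Suc (degree q). cscale (coeff (pCons 0 q) i) ((\<tau> ^^ i) X)) = \<tau> (poly_map q X)"
    by (subst sum.atMost_Suc_shift) (simp add: poly_map_def sum scale)
  moreover have "(\<Sum>i\<le>Suc (degree q). cscale (z * coeff q i) ((\<tau> ^^ i) X)) = cscale z (poly_map q X)"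
    by (subst poly_map_altdef[of q "Suc (degree q)"]) (simp_all add: cmat.scale_sum_right coeff_eq_0)
  ultimately show ?thesis by simp
qed

text \<open>The orbit of \<open>X\<close> lies in a finite-dimensional real space, so its first
  \<open>DIM('d cmat) + 1\<close> members satisfy a linear relation, whose coefficients form the
  polynomial.\<close>

lemma annihilating_poly: "\<exists>p. p \<noteq> 0 \<and> poly_map p X = 0"
proof (cases "inj_on (\<lambda>i. (\<tau> ^^ i) X) {..DIM('d cmat)}")
  case False
  then obtain i j where ij: "(\<tau> ^^ i) X = (\<tau> ^^ j) X" "i < j"
    unfolding inj_on_def by (metis nat_neq_iff)
  \<comment> \<open>Linear dependence is a notion for sets, so two equal iterates are treated
    apart.\<close>
  define p :: "complex poly" where "p = monom 1 j - monom 1 i"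
  have "coeff p j = 1" using ij by (simp add: p_def)
  then have "p \<noteq> 0" by auto
  have "degree p \<le> j"
    unfolding p_def using ij by (intro degree_diff_le) (auto intro: order.trans[OF degree_monom_le])
  have "poly_map p X = (\<Sum>k\<le>j. (if k = j then (\<tau> ^^ k) X else 0) - (if k = i then (\<tau> ^^ k) X else 0))"
    unfolding poly_map_altdef[OF \<open>degree p \<le> j\<close>]
    by (intro sum.cong) (auto simp: p_def cmat.scale_left_diff_distrib)
  also have "\<dots> = 0"
    using ij by (simp add: sum_subtractf)
  finally show ?thesis using \<open>p \<noteq> 0\<close> by blast
next
  case True
  let ?n = "DIM('d cmat)"
  let ?S = "(\<lambda>i. (\<tau> ^^ i) X) ` {..?n}"
  have "card ?S > ?n" unfolding card_image[OF True] by simp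
  then have "dependent ?S" by (intro dependent_biggerset) auto
  then obtain u where u: "\<exists>v\<in>?S. u v \<noteq> 0" "(\<Sum>v\<in>?S. u v *\<^sub>R v) = 0"
    by (auto simp: real_vector.dependent_finite)
  define p where "p = (\<Sum>i\<le>?n. monom (complex_of_real (u ((\<tau> ^^ i) X))) i)"
  have c: "coeff p i = (if i \<le> ?n then complex_of_real (u ((\<tau> ^^ i) X)) else 0)" for i
    by (simp add: p_def coeff_sum)
  have "p \<noteq> 0" using u(1) by (auto simp: poly_eq_iff c)
  have "degree p \<le> ?n" by (rule degree_le) (simp add: c)
  have "poly_map p X = (\<Sum>i\<le>?n. u ((\<tau> ^^ i) X) *\<^sub>R (\<tau> ^^ i) X)"
    unfolding poly_map_altdef[OF \<open>degree p \<le> ?n\<close>] by (intro sum.cong) (simp_all add: c cscale_of_real)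
  also have "\<dots> = 0" using u(2) unfolding sum.reindex[OF True] o_def .
  finally show ?thesis using \<open>p \<noteq> 0\<close> by blast
qed

text \<open>An eigenvector of the map induced on the quotient by \<open>W\<close>.\<close>

lemma eigenvector_mod_subspace:
  assumes W: "cmat.subspace W" "W \<noteq> UNIV"
  obtains \<mu> X where "X \<notin> W" "\<tau> X - cscale \<mu> X \<in> W"
proof -
  obtain Y where Y: "Y \<notin> W" using W(2) by blast
  let ?A = "\<lambda>p. p \<noteq> 0 \<and> poly_map p Y \<in> W"
  obtain p0 where "?A p0" using annihilating_poly[of Y] cmat.subspace_0[OF W(1)] by metis
  \<comment> \<open>By minimality of the degree, splitting off a linear factor of \<open>p\<close>
    leaves a \<open>q\<close> with \<open>poly_map q Y\<close> outside \<open>W\<close>; this is the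
    desired eigenvector modulo \<open>W\<close>.\<close>
  then obtain p where p: "?A p" and min: "\<And>q. ?A q \<Longrightarrow> degree p \<le> degree q"
    using ex_has_least_nat[of ?A p0 degree] by blast
  have "degree p \<noteq> 0"
  proof
    assume "degree p = 0"
    then obtain c where c: "p = [:c:]" by (rule degree_eq_zeroE)
    with p have "c \<noteq> 0" "cscale c Y \<in> W" by (auto simp: poly_map_def)
    then show False
      using Y cmat.subspace_scale[OF W(1), of "cscale c Y" "inverse c"] by simp
  qed
  then obtain z where "poly p z = 0"
    using fundamental_theorem_of_algebra[of p] constant_degree[of p] by metis
  then obtain q where q: "p = [:- z, 1:] * q" by (auto simp: poly_eq_0_iff_dvd)
  with p have "q \<noteq> 0" by auto
  then have "degree p = Suc (degree q)" unfolding q by (subst degree_mult_eq) auto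
  then have "poly_map q Y \<notin> W" using min[of q] \<open>q \<noteq> 0\<close> by fastforce
  with p show ?thesis using that poly_map_linear_factor[of z q Y] unfolding q by auto
qed

abbreviation "P \<equiv> peripheral_space \<tau>"

lemma subspace_P: "cmat.subspace P"
  unfolding peripheral_space_def by (rule cmat.subspace_span)

lemma eigenvector_in_P: "cmod \<mu> = 1 \<Longrightarrow> \<tau> X = cscale \<mu> X \<Longrightarrow> X \<in> P"
  unfolding peripheral_space_def by (rule cmat.span_base) blast

text \<open>Span induction in a form whose step hands over the eigenvalue and the membership of both
  summands in \<open>P\<close>.\<close>

lemma P_induct [consumes 1, case_names base step]:
  assumes "X \<in> P" "Q 0"
    and "\<And>c \<mu> X Y. cmod \<mu> = 1 \<Longrightarrow> \<tau> X = cscale \<mu> X \<Longrightarrow> X \<in> P \<Longrightarrow> Y \<in> P \<Longrightarrow> Q Y \<Longrightarrow> Q (cscale c X + Y)"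
  shows "Q X"
proof -
  have "X \<in> P \<and> Q X"
    using assms(1)[unfolded peripheral_space_def]
  proof (induction rule: cmat.span_induct_alt)
    case base
    show ?case using assms(2) cmat.subspace_0[OF subspace_P] by simp
  next
    case (step c x y)
    then obtain \<mu> where "cmod \<mu> = 1" "\<tau> x = cscale \<mu> x" by blast
    then show ?case
      using step eigenvector_in_P assms(3) subspace_P
      by (simp add: cmat.subspace_add cmat.subspace_scale)
  qed
  then show ?thesis ..
qed

lemma map_in_P: "X \<in> P \<Longrightarrow> \<tau> X \<in> P"
proof (induction rule: P_induct)
  case base
  show ?case using cmat.subspace_0[OF subspace_P] by simp
next
  case (step c \<mu> X Y)
  then show ?case
    using subspace_P by (simp add: add scale cmat.subspace_add cmat.subspace_scale)
qed

text \<open>Solves \<open>(\<tau> - \<mu>) Y = X\<close> in \<open>P\<close>, up to an eigenvector obstruction \<open>E\<close>.\<close>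

lemma P_resolvent:
  assumes "X \<in> P"
  shows "\<exists>Y\<in>P. \<exists>E. \<tau> E = cscale \<mu> E \<and> (cmod \<mu> \<noteq> 1 \<longrightarrow> E = 0) \<and> \<tau> Y - cscale \<mu> Y = X - E"
  using assms
proof (induction rule: P_induct)
  case base
  show ?case using cmat.subspace_0[OF subspace_P] by (intro bexI[of _ 0] exI[of _ 0]) simp_all
next
  case (step c \<nu> X Z)
  then obtain Y E where Y: "Y \<in> P" "\<tau> E = cscale \<mu> E" "cmod \<mu> \<noteq> 1 \<longrightarrow> E = 0"
    "\<tau> Y - cscale \<mu> Y = Z - E" by blast
  show ?case
  proof (cases "\<nu> = \<mu>")
    case True
    \<comment> \<open>The new term is killed by \<open>\<tau> - \<mu>\<close> and so joins the
      obstruction; here \<open>cmod \<mu> = 1\<close>, which permits a nonzero one.\<close>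
    have "\<tau> (cscale c X + E) = cscale \<mu> (cscale c X + E)"
      using step Y True by (simp add: add scale cmat.scale_right_distrib mult.commute)
    then show ?thesis
      using step Y True by (intro bexI[of _ Y] exI[of _ "cscale c X + E"]) simp_all
  next
    case False
    \<comment> \<open>On the eigenspace for \<open>\<nu>\<close>, the map
      \<open>\<tau> - \<mu>\<close> is multiplication by \<open>\<nu> - \<mu>\<close> and can be
      inverted.\<close>
    let ?V = "cscale (c / (\<nu> - \<mu>)) X"
    have "\<tau> ?V - cscale \<mu> ?V = cscale (c / (\<nu> - \<mu>) * \<nu> - \<mu> * (c / (\<nu> - \<mu>))) X"
      by (simp only: scale step cmat.scale_scale cmat.scale_left_diff_distrib)
    also have "c / (\<nu> - \<mu>) * \<nu> - \<mu> * (c / (\<nu> - \<mu>)) = c"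
    proof -
      have "c / (\<nu> - \<mu>) * \<nu> - \<mu> * (c / (\<nu> - \<mu>)) = c / (\<nu> - \<mu>) * (\<nu> - \<mu>)"
        by (simp only: right_diff_distrib mult.commute[of \<mu>])
      then show ?thesis using False by simp
    qed
    finally have V: "\<tau> ?V - cscale \<mu> ?V = cscale c X" .
    have "?V + Y \<in> P" using step Y subspace_P by (simp add: cmat.subspace_add cmat.subspace_scale)
    moreover have "\<tau> (?V + Y) - cscale \<mu> (?V + Y) = (cscale c X + Z) - E"
      using V Y(4) by (simp only: add cmat.scale_right_distrib) (simp add: algebra_simps)
    ultimately show ?thesis using Y by blast
  qed
qed

section \<open>The subspace of decaying orbits\<close>

definition N :: "'d cmat set" where
  "N = {X. (\<lambda>n. (\<tau> ^^ n) X) \<longlonglongrightarrow> 0}"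

lemma subspace_N: "cmat.subspace N"
proof (rule cmat.subspaceI)
  show "0 \<in> N" by (simp add: N_def pow_zero)
  show "X + Y \<in> N" if "X \<in> N" "Y \<in> N" for X Y
    using tendsto_add[OF that[unfolded N_def, simplified]] by (simp add: N_def pow_add)
  show "cscale c X \<in> N" if "X \<in> N" for c X
    using tendsto_cscale[OF tendsto_const that[unfolded N_def, simplified], of c]
    by (simp add: N_def pow_scale)
qed

lemma map_in_N: "X \<in> N \<Longrightarrow> \<tau> X \<in> N"
  using LIMSEQ_Suc[of "\<lambda>n. (\<tau> ^^ n) X" 0] by (simp add: N_def funpow_swap1)

text \<open>The orbit norms satisfy the recursion of \<open>contraction_recursion_tendsto_0\<close>
  with ratio \<open>cmod \<mu>\<close>.\<close>

lemma N_resolvent_inside: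
  assumes "cmod \<mu> < 1" "\<tau> X - cscale \<mu> X \<in> N"
  shows "X \<in> N"
proof -
  let ?Z = "\<tau> X - cscale \<mu> X"
  have rec: "(\<tau> ^^ Suc n) X = cscale \<mu> ((\<tau> ^^ n) X) + (\<tau> ^^ n) ?Z" for n
    by (simp add: pow_diff pow_scale funpow_swap1)
  have "(\<lambda>n. norm ((\<tau> ^^ n) X)) \<longlonglongrightarrow> 0"
  proof (rule contraction_recursion_tendsto_0)
    show "norm ((\<tau> ^^ Suc n) X) \<le> cmod \<mu> * norm ((\<tau> ^^ n) X) + norm ((\<tau> ^^ n) ?Z)" for n
      unfolding rec using norm_triangle_ineq by (metis norm_cscale)
    show "(\<lambda>n. norm ((\<tau> ^^ n) ?Z)) \<longlonglongrightarrow> 0"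
      using assms(2) by (simp add: N_def tendsto_norm_zero)
  qed (use assms in auto)
  then show ?thesis by (simp add: N_def tendsto_norm_zero_iff)
qed

text \<open>An eigenvector with \<open>cmod \<mu> \<ge> 1\<close> cannot decay unless it is zero. So
  \<open>\<tau> - \<mu>\<close> is injective on the finite-dimensional space \<open>N\<close>, hence
  onto.\<close>

lemma N_resolvent_outside:
  assumes "cmod \<mu> \<ge> 1" "Z \<in> N"
  shows "\<exists>Y\<in>N. \<tau> Y - cscale \<mu> Y = Z"
proof -
  let ?g = "\<lambda>Y. \<tau> Y - cscale \<mu> Y"
  \<comment> \<open>The dimension count is done over the reals.\<close>
  have sub: "subspace N"
    using subspace_N unfolding cmat.subspace_def subspace_def by (auto simp: cscale_of_real[symmetric])
  have lin: "linear ?g"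
    by (intro linear_compose_sub bounded_linear.linear bounded_linear_map
        bounded_bilinear.bounded_linear_right[OF bounded_bilinear_cscale])
  have into: "?g ` N \<subseteq> N"
    using cmat.subspace_diff[OF subspace_N map_in_N cmat.subspace_scale[OF subspace_N]] by blast
  have "inj_on ?g (span N)"
    unfolding span_eq_iff[THEN iffD2, OF sub] linear_injective_on_subspace_0[OF lin sub]
  proof (intro ballI impI)
    fix Y assume Y: "Y \<in> N" "?g Y = 0"
    then have "(\<tau> ^^ n) Y = cscale (\<mu> ^ n) Y" for n by (simp add: eigenvector_power)
    then have "norm Y \<le> norm ((\<tau> ^^ n) Y)" for n
      using assms(1) by (simp add: norm_power mult_le_cancel_right1 one_le_power)
    moreover have "(\<lambda>n. norm ((\<tau> ^^ n) Y)) \<longlonglongrightarrow> 0"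
      using Y by (simp add: N_def tendsto_norm_zero)
    ultimately have "norm Y \<le> 0" by (intro LIMSEQ_le_const) auto
    then show "Y = 0" by simp
  qed
  then have "dim (?g ` N) = dim N" using lin by (rule dim_image_eq[rotated])
  then have "?g ` N = N"
    by (intro subspace_dim_equal linear_subspace_image lin sub into) simp
  then show ?thesis using assms(2) by (metis (no_types, lifting) imageE)
qed

end

locale power_bounded_cmat_endo = cmat_endo \<tau>
  for \<tau> :: "'d::finite cmat \<Rightarrow> 'd cmat" +
  fixes C :: real
  assumes power_bounded: "norm ((\<tau> ^^ n) X) \<le> C * norm X"
begin

text \<open>A Jordan block, or an eigenvalue outside the disc, makes the powers unbounded.\<close>

lemma eigenvector_of_jordan_pair:
  assumes "\<tau> X = cscale \<mu> X + E" "\<tau> E = cscale \<mu> E" "cmod \<mu> \<ge> 1" "cmod \<mu> \<noteq> 1 \<Longrightarrow> E = 0"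
  shows "X \<in> P"
proof (cases "cmod \<mu> = 1")
  case False
  then have "(\<tau> ^^ n) X = cscale (\<mu> ^ n) X" for n
    using assms by (simp add: eigenvector_power)
  then have le: "cmod \<mu> ^ n * norm X \<le> C * norm X" for n
    using power_bounded[of n X] by (simp add: norm_power)
  obtain n where "C < cmod \<mu> ^ n"
    using False assms(3) real_arch_pow[of "cmod \<mu>" C] by auto
  then have "X = 0"
    using le[of n] by (metis mult_le_cancel_right_pos norm_le_zero_iff not_le)
  then show ?thesis using cmat.subspace_0[OF subspace_P] by simp
next
  case True
  \<comment> \<open>The usual formula for powers of a Jordan block, multiplied by
    \<open>\<mu>\<close> to avoid the exponent \<open>n - 1\<close>.\<close>
  have pow: "cscale \<mu> ((\<tau> ^^ n) X) = cscale (\<mu> ^ Suc n) X + cscale (of_nat n * \<mu> ^ n) E" for n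
  proof (induction n)
    case (Suc n)
    have "cscale \<mu> ((\<tau> ^^ Suc n) X) = \<tau> (cscale \<mu> ((\<tau> ^^ n) X))" by (simp add: scale)
    also have "\<dots> = cscale (\<mu> ^ Suc n) (\<tau> X) + cscale (of_nat n * \<mu> ^ n) (\<tau> E)"
      unfolding Suc by (simp add: add scale)
    also have "\<dots> = cscale (\<mu> ^ Suc (Suc n)) X + cscale (of_nat (Suc n) * \<mu> ^ Suc n) E"
      by (simp add: assms cscale_def vec_eq_iff algebra_simps)
    finally show ?case .
  qed simp
  have le: "real n * norm E \<le> (C + 1) * norm X" for n
  proof -
    have "real n * norm E = norm (cscale (of_nat n * \<mu> ^ n) E)"
      using True by (simp add: norm_mult norm_power)
    also have "\<dots> = norm (cscale \<mu> ((\<tau> ^^ n) X) - cscale (\<mu> ^ Suc n) X)"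
      by (simp add: pow)
    also have "\<dots> \<le> norm ((\<tau> ^^ n) X) + norm X"
      using norm_triangle_ineq4[of "cscale \<mu> ((\<tau> ^^ n) X)" "cscale (\<mu> ^ Suc n) X"] True
      by (simp add: norm_mult norm_power)
    finally show ?thesis using power_bounded[of n X] by (simp add: algebra_simps)
  qed
  have "E = 0"
  proof (rule ccontr)
    assume "E \<noteq> 0"
    then obtain n where "(C + 1) * norm X < real n * norm E"
      using reals_Archimedean3[of "norm E"] by auto
    with le[of n] show False by simp
  qed
  then show ?thesis using assms(1) eigenvector_in_P[OF True, of X] by simp
qed

text \<open>Were the sum proper, there would be an eigenvector \<open>X\<close> modulo it.
  Corrections from \<open>P\<close> and \<open>N\<close> turn \<open>X\<close> into an element of
  \<open>P\<close>, or of \<open>N\<close> when \<open>cmod \<mu> < 1\<close>, so \<open>X\<close>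
  lies in the sum after all.\<close>

lemma P_plus_N: "\<exists>Y\<in>P. \<exists>Z\<in>N. X = Y + Z"
proof -
  let ?W = "{Y + Z |Y Z. Y \<in> P \<and> Z \<in> N}"
  have W: "cmat.subspace ?W" by (rule cmat.subspace_sums[OF subspace_P subspace_N])
  have "?W = UNIV"
  proof (rule ccontr)
    assume "?W \<noteq> UNIV"
    with W obtain \<mu> X where X: "X \<notin> ?W" "\<tau> X - cscale \<mu> X \<in> ?W"
      by (rule eigenvector_mod_subspace)
    then obtain Y Z where YZ: "\<tau> X - cscale \<mu> X = Y + Z" "Y \<in> P" "Z \<in> N" by blast
    obtain Y' E where Y': "Y' \<in> P" and E: "\<tau> E = cscale \<mu> E" "cmod \<mu> \<noteq> 1 \<longrightarrow> E = 0"
      "\<tau> Y' - cscale \<mu> Y' = Y - E"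
      using P_resolvent[OF YZ(2)] by blast
    have eq: "\<tau> (X - Y') - cscale \<mu> (X - Y') = E + Z"
      using YZ(1) E(3) by (simp add: diff cmat.scale_right_diff_distrib algebra_simps)
    have "\<exists>Z'\<in>N. X - Y' - Z' \<in> P"
    proof (cases "cmod \<mu> < 1")
      case True
      then have "\<tau> (X - Y') - cscale \<mu> (X - Y') \<in> N" using eq E(2) YZ(3) by simp
      then have "X - Y' \<in> N" by (rule N_resolvent_inside[OF True])
      then show ?thesis using cmat.subspace_0[OF subspace_P] by (intro bexI[of _ "X - Y'"]) simp_all
    next
      case False
      then obtain Z' where Z': "Z' \<in> N" "\<tau> Z' - cscale \<mu> Z' = Z"
        using N_resolvent_outside[of \<mu> Z] YZ(3) by auto
      \<comment> \<open>Subtracting \<open>Z'\<close> removes the error in \<open>N\<close>; what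
        remains is the eigenvector \<open>E\<close>, so a Jordan pair results.\<close>
      have "\<tau> (X - Y' - Z') - cscale \<mu> (X - Y' - Z') =
          (\<tau> (X - Y') - cscale \<mu> (X - Y')) - (\<tau> Z' - cscale \<mu> Z')"
        by (simp only: diff[of "X - Y'"] cmat.scale_right_diff_distrib[of \<mu> "X - Y'"]) simp
      also have "\<dots> = E" unfolding eq Z'(2) by simp
      finally have "\<tau> (X - Y' - Z') = cscale \<mu> (X - Y' - Z') + E" by (simp add: diff_eq_eq add.commute)
      then have "X - Y' - Z' \<in> P"
        by (rule eigenvector_of_jordan_pair) (use E False in auto)
      then show ?thesis using Z' by blast
    qed
    then obtain Z' where "Z' \<in> N" "X - Y' - Z' \<in> P" by blast
    moreover from this have "X - Y' - Z' + Y' \<in> P" using Y' subspace_P by (intro cmat.subspace_add)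
    moreover have "X = (X - Y' - Z' + Y') + Z'" by simp
    ultimately show False using X(1) by blast
  qed
  then show ?thesis by blast
qed

text \<open>Differences of indices along a convergent subsequence of the powers are almost periods.\<close>

lemma ex_recurrence: "\<exists>m. \<forall>X\<in>P. (\<forall>k. k \<le> m k) \<and> (\<lambda>k. (\<tau> ^^ Suc (m k)) X) \<longlonglongrightarrow> X"
proof -
  \<comment> \<open>Compactness is applied to the operators themselves, so that one subsequence
    serves all \<open>X\<close>.\<close>
  define T where "T n = Blinfun (\<tau> ^^ n)" for n
  have T: "blinfun_apply (T n) = \<tau> ^^ n" for n
    unfolding T_def by (rule bounded_linear_Blinfun_apply[OF bounded_linear_pow])
  have "norm (T n) \<le> \<bar>C\<bar>" for n
  proof (rule norm_blinfun_bound)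
    show "norm (T n X) \<le> \<bar>C\<bar> * norm X" for X
      unfolding T using power_bounded[of n X] by (smt (verit) mult_right_mono norm_ge_zero)
  qed simp
  then have "bounded (range T)" by (auto simp: bounded_iff)
  then obtain L r where r: "strict_mono (r :: nat \<Rightarrow> nat)" and "(T \<circ> r) \<longlonglongrightarrow> L"
    using bounded_imp_convergent_subsequence by blast
  then have lim: "(\<lambda>k. (\<tau> ^^ r k) X) \<longlonglongrightarrow> L X" for X
    using blinfun.tendsto[OF _ tendsto_const, of "T \<circ> r" L sequentially X] by (simp add: T)
  \<comment> \<open>\<open>Suc (m k)\<close> is the gap between two members of the subsequence; both
    positions and their distance tend to infinity. Writing it as a successor records that it is
    positive.\<close>
  define m where "m k = r (Suc k + Suc k) - r (Suc k) - 1" for k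
  have gap: "r i + k \<le> r (i + k)" for i k
  proof (induction k)
    case (Suc k)
    then show ?case using strict_monoD[OF r, of "i + k" "i + Suc k"] by simp
  qed simp
  have m: "r (Suc k) + Suc (m k) = r (Suc k + Suc k)" "k \<le> m k" for k
    using gap[of "Suc k" "Suc k"] unfolding m_def by linarith+
  have "(\<lambda>k. (\<tau> ^^ Suc (m k)) X) \<longlonglongrightarrow> X" if "X \<in> P" for X
    using that
  proof (induction rule: P_induct)
    case base
    show ?case by (simp only: pow_zero tendsto_const)
  next
    case (step c \<mu> X Y)
    have "(\<lambda>k. (\<tau> ^^ r (Suc k + Suc k)) X - (\<tau> ^^ r (Suc k)) X) \<longlonglongrightarrow> L X - L X"
    proof (intro tendsto_diff)
      have "strict_mono (\<lambda>k. Suc k + Suc k)" by (auto simp: strict_mono_def)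
      from LIMSEQ_subseq_LIMSEQ[OF lim this]
      show "(\<lambda>k. (\<tau> ^^ r (Suc k + Suc k)) X) \<longlonglongrightarrow> L X" unfolding o_def .
      show "(\<lambda>k. (\<tau> ^^ r (Suc k)) X) \<longlonglongrightarrow> L X" by (rule LIMSEQ_Suc[OF lim])
    qed
    then have "(\<lambda>k. norm ((\<tau> ^^ r (Suc k + Suc k)) X - (\<tau> ^^ r (Suc k)) X)) \<longlonglongrightarrow> 0"
      unfolding diff_self by (rule tendsto_norm_zero)
    moreover have "norm ((\<tau> ^^ r (Suc k + Suc k)) X - (\<tau> ^^ r (Suc k)) X) = norm ((\<tau> ^^ Suc (m k)) X - X)" for k
    proof -
      \<comment> \<open>The common factor has modulus 1, so small differences between powers mean a
        small distance from \<open>X\<close> itself.\<close>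
      have "(\<tau> ^^ r (Suc k + Suc k)) X - (\<tau> ^^ r (Suc k)) X = cscale (\<mu> ^ r (Suc k)) ((\<tau> ^^ Suc (m k)) X - X)"
        unfolding m(1)[symmetric] eigenvector_power[OF step(2)]
        by (simp only: power_add cmat.scale_right_diff_distrib cmat.scale_scale)
      then show ?thesis using step(1) by (simp add: norm_power)
    qed
    ultimately have "(\<lambda>k. norm ((\<tau> ^^ Suc (m k)) X - X)) \<longlonglongrightarrow> 0" by (simp only:)
    then have "(\<lambda>k. (\<tau> ^^ Suc (m k)) X - X) \<longlonglongrightarrow> 0" by (rule tendsto_norm_zero_cancel)
    then have "(\<lambda>k. (\<tau> ^^ Suc (m k)) X) \<longlonglongrightarrow> X" by (simp only: LIM_zero_iff)
    then show ?case
      unfolding pow_add pow_scale by (intro tendsto_add tendsto_cscale tendsto_const step(5))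
  qed
  then show ?thesis using m(2) by blast
qed

definition recurrence :: "nat \<Rightarrow> nat" where
  "recurrence = (SOME m. \<forall>X\<in>P. (\<forall>k. k \<le> m k) \<and> (\<lambda>k. (\<tau> ^^ Suc (m k)) X) \<longlonglongrightarrow> X)"

text \<open>The growth condition sits under the quantifier over \<open>P\<close>;
  \<open>0 \<in> P\<close> releases it.\<close>

lemma recurrence_ge: "k \<le> recurrence k"
  and recurrence_tendsto: "X \<in> P \<Longrightarrow> (\<lambda>k. (\<tau> ^^ Suc (recurrence k)) X) \<longlonglongrightarrow> X"
  using someI_ex[OF ex_recurrence] cmat.subspace_0[OF subspace_P]
  unfolding recurrence_def[symmetric] by blast+

lemma recurrence_tendsto_N:
  assumes "X \<in> N"
  shows "(\<lambda>k. (\<tau> ^^ Suc (recurrence k)) X) \<longlonglongrightarrow> 0"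
proof -
  have "filterlim recurrence at_top sequentially"
    by (rule filterlim_at_top_mono[OF filterlim_ident]) (simp add: recurrence_ge)
  then show ?thesis
    using filterlim_compose[OF LIMSEQ_Suc[OF assms[unfolded N_def, simplified]]] by simp
qed

text \<open>The projection onto \<open>P\<close> along \<open>N\<close>; expressing it by powers of \<open>\<tau>\<close> shows its positivity.\<close>

definition pproj :: "'d cmat \<Rightarrow> 'd cmat" where
  "pproj X = lim (\<lambda>k. (\<tau> ^^ Suc (recurrence k)) X)"

lemma pproj_sum:
  assumes "Y \<in> P" "Z \<in> N"
  shows "(\<lambda>k. (\<tau> ^^ Suc (recurrence k)) (Y + Z)) \<longlonglongrightarrow> Y" "pproj (Y + Z) = Y"
proof -
  show *: "(\<lambda>k. (\<tau> ^^ Suc (recurrence k)) (Y + Z)) \<longlonglongrightarrow> Y"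
    using tendsto_add[OF recurrence_tendsto recurrence_tendsto_N, OF assms]
    by (simp only: pow_add add_0_right)
  then show "pproj (Y + Z) = Y" unfolding pproj_def by (rule limI)
qed

lemma
  shows pproj_tendsto: "(\<lambda>k. (\<tau> ^^ Suc (recurrence k)) X) \<longlonglongrightarrow> pproj X"
    and pproj_in_P: "pproj X \<in> P"
    and diff_pproj_in_N: "X - pproj X \<in> N"
proof -
  obtain Y Z where *: "Y \<in> P" "Z \<in> N" "X = Y + Z" using P_plus_N by blast
  then show "(\<lambda>k. (\<tau> ^^ Suc (recurrence k)) X) \<longlonglongrightarrow> pproj X" "pproj X \<in> P" "X - pproj X \<in> N"
    using pproj_sum[OF *(1,2)] by simp_all
qed

lemma pproj_ident: "X \<in> P \<Longrightarrow> pproj X = X"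
  using pproj_sum(2)[of X 0] cmat.subspace_0[OF subspace_N] by simp

text \<open>As the fixed-point set of a continuous map, \<open>P\<close> is closed.\<close>

lemma P_eq_fixed: "P = {X. pproj X = X}"
  by (auto simp: pproj_ident) (metis pproj_in_P)

lemma linear_pproj: "Vector_Spaces.linear cscale cscale pproj"
proof unfold_locales
  show "pproj (X + Y) = pproj X + pproj Y" for X Y
    by (rule LIMSEQ_unique[OF pproj_tendsto])
      (unfold pow_add, intro tendsto_add pproj_tendsto)
  show "pproj (cscale c X) = cscale c (pproj X)" for c X
    by (rule LIMSEQ_unique[OF pproj_tendsto])
      (unfold pow_scale, intro tendsto_cscale tendsto_const pproj_tendsto)
qed

sublocale pproj: cmat_endo pproj
  unfolding cmat_endo_def by (rule linear_pproj)

lemma pproj_commute: "pproj (\<tau> X) = \<tau> (pproj X)"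
proof (rule LIMSEQ_unique[OF pproj_tendsto])
  show "(\<lambda>k. (\<tau> ^^ Suc (recurrence k)) (\<tau> X)) \<longlonglongrightarrow> \<tau> (pproj X)"
    using tendsto_map[OF pproj_tendsto[of X]] by (simp add: funpow_swap1)
qed

lemma closed_P: "closed P"
  unfolding P_eq_fixed
  by (intro closed_Collect_eq linear_continuous_on pproj.bounded_linear_map continuous_on_id)

text \<open>The recurrence times are positive, so the iterates returning to \<open>X\<close> depend
  on \<open>\<tau> X\<close> alone, which gives injectivity. Eigenvectors have preimages because
  their eigenvalues are nonzero.\<close>

lemma bij_betw_P: "bij_betw \<tau> P P"
proof -
  have "inj_on \<tau> P"
  proof (rule inj_onI)
    fix X Y assume XY: "X \<in> P" "Y \<in> P" "\<tau> X = \<tau> Y"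
    have "(\<lambda>k. (\<tau> ^^ Suc (recurrence k)) X) \<longlonglongrightarrow> Y"
      using recurrence_tendsto[OF XY(2)] XY(3) by (simp add: funpow_swap1)
    then show "X = Y" using recurrence_tendsto[OF XY(1)] LIMSEQ_unique by blast
  qed
  moreover have "X \<in> \<tau> ` P" if "X \<in> P" for X
    using that
  proof (induction rule: P_induct)
    case base
    show ?case using cmat.subspace_0[OF subspace_P] by (intro image_eqI[of _ _ 0]) simp_all
  next
    case (step c \<mu> X Y)
    then obtain Z where Z: "Z \<in> P" "Y = \<tau> Z" by blast
    have "\<mu> \<noteq> 0" using step(1) by auto
    then have "cscale c X + Y = \<tau> (cscale (c / \<mu>) X + Z)"
      using step(2) Z by (simp add: add scale)
    then show ?case
      using step Z subspace_P by (auto intro: cmat.subspace_add cmat.subspace_scale)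
  qed
  ultimately show ?thesis using map_in_P by (auto simp: bij_betw_def)
qed

end

section \<open>The peripheral product of a UCP map\<close>

locale ucp_map =
  fixes \<tau> :: "'d::finite cmat \<Rightarrow> 'd cmat"
  assumes ucp: "ucp \<tau>"

sublocale ucp_map \<subseteq> power_bounded_cmat_endo \<tau> "(real CARD('d))\<^sup>2"
  by (intro power_bounded_cmat_endo.intro power_bounded_cmat_endo_axioms.intro)
    (simp_all add: cmat_endo_def ucp_linear[OF ucp] ucp_power_bounded[OF ucp])

context ucp_map
begin

lemma psd_pow: "psd A \<Longrightarrow> psd ((\<tau> ^^ n) A)"
  by (induction n) (simp_all add: ucp_psd[OF ucp])

lemma psd_pproj: "psd A \<Longrightarrow> psd (pproj A)"
  by (rule psd_limit[OF pproj_tendsto psd_pow])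

text \<open>The adjoint of an eigenvector for \<open>\<mu>\<close> is one for
  \<open>cnj \<mu>\<close>, which is again unimodular.\<close>

lemma cadjoint_in_P: "X \<in> P \<Longrightarrow> cadjoint X \<in> P"
proof (induction rule: P_induct)
  case base
  have "cadjoint 0 = (0 :: 'd cmat)" by (simp add: cadjoint_def vec_eq_iff)
  then show ?case using cmat.subspace_0[OF subspace_P] by simp
next
  case (step c \<mu> X Y)
  have "\<tau> (cadjoint X) = cscale (cnj \<mu>) (cadjoint X)"
    by (simp add: ucp_cadjoint[OF ucp] step cadjoint_cscale)
  then have "cadjoint X \<in> P" using step(1) by (intro eigenvector_in_P[of "cnj \<mu>"]) simp_all
  then show ?case
    using step subspace_P
    by (simp add: cadjoint_add cadjoint_cscale cmat.subspace_add cmat.subspace_scale)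
qed

text \<open>The Schwarz inequality iterated under \<open>pproj\<close>: the image of the previous
  defect and the projected one-step defect telescope, because \<open>pproj\<close> commutes with
  \<open>\<tau>\<close>.\<close>

lemma pproj_gram_schwarz_pow:
  "psd ((\<tau> ^^ n) (pproj (cadjoint X ** X)) - pproj (cadjoint ((\<tau> ^^ n) X) ** (\<tau> ^^ n) X))"
proof (induction n)
  case 0
  show ?case by (simp add: psd_def)
next
  case (Suc n)
  let ?Y = "(\<tau> ^^ n) X"
  have "psd (pproj (\<tau> (cadjoint ?Y ** ?Y) - cadjoint (\<tau> ?Y) ** \<tau> ?Y))"
    by (intro psd_pproj ucp_schwarz ucp)
  from psd_add[OF ucp_psd[OF ucp Suc] this] show ?case
    by (simp add: diff pproj.diff pproj_commute)
qed

text \<open>The defect \<open>G\<close> in the Schwarz inequality is positive, and the inequality for the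
  powers of \<open>\<tau>\<close> bounds its orbit by a sequence that vanishes along the recurrence times;
  as \<open>G\<close> itself recurs, \<open>G = 0\<close>.\<close>

lemma map_pproj_gram:
  assumes "X \<in> P"
  shows "\<tau> (pproj (cadjoint X ** X)) = pproj (cadjoint (\<tau> X) ** \<tau> X)"
proof -
  define Q where "Q X = pproj (cadjoint X ** X)" for X
  define G where "G = \<tau> (Q X) - Q (\<tau> X)"
  define s where "s k = Suc (recurrence k)" for k
  have Q_in_P: "Q Y \<in> P" for Y unfolding Q_def by (rule pproj_in_P)
  have "G \<in> P"
    unfolding G_def by (intro cmat.subspace_diff subspace_P map_in_P Q_in_P)
  have "psd G"
    using pproj_gram_schwarz_pow[of 1 X] by (simp add: G_def Q_def)
  \<comment> \<open>After cancellation this is \<open>\<tau>\<close> applied to the Schwarz defect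
    of \<open>\<tau> X\<close> for the power \<open>recurrence k\<close>, one less than
    \<open>s k\<close>.\<close>
  have bound: "psd (\<tau> ((\<tau> ^^ s k) (Q X) - Q ((\<tau> ^^ s k) X)) - (\<tau> ^^ s k) G)" for k
  proof -
    let ?n = "recurrence k"
    have "psd (\<tau> ((\<tau> ^^ ?n) (Q (\<tau> X)) - Q ((\<tau> ^^ ?n) (\<tau> X))))"
      using pproj_gram_schwarz_pow[of ?n "\<tau> X"] by (intro ucp_psd[OF ucp]) (simp add: Q_def)
    moreover have "\<tau> ((\<tau> ^^ s k) (Q X) - Q ((\<tau> ^^ s k) X)) - (\<tau> ^^ s k) G =
        \<tau> ((\<tau> ^^ ?n) (Q (\<tau> X)) - Q ((\<tau> ^^ ?n) (\<tau> X)))"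
      unfolding s_def funpow_Suc_right o_apply G_def pow_diff diff funpow_swap1[of \<tau> ?n]
      by simp
    ultimately show ?thesis by simp
  qed
  \<comment> \<open>All iterates here recur to their starting points, so the positive matrices of
    \<open>bound\<close> converge to \<open>- G\<close>.\<close>
  have "(\<lambda>k. \<tau> ((\<tau> ^^ s k) (Q X) - Q ((\<tau> ^^ s k) X)) - (\<tau> ^^ s k) G) \<longlonglongrightarrow> \<tau> (Q X - Q X) - G"
    unfolding s_def
  proof (intro tendsto_diff tendsto_map recurrence_tendsto Q_in_P \<open>G \<in> P\<close>)
    show "(\<lambda>k. Q ((\<tau> ^^ Suc (recurrence k)) X)) \<longlonglongrightarrow> Q X"
      unfolding Q_def
      by (intro pproj.tendsto_map tendsto_matrix_mult tendsto_cadjoint recurrence_tendsto assms)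
  qed
  from psd_limit[OF this bound] have "psd (- G)" by simp
  with \<open>psd G\<close> have "G = 0" by (rule psd_antisym)
  then show ?thesis by (simp add: G_def Q_def)
qed

text \<open>Polarization of \<open>map_pproj_gram\<close>: the defect \<open>S\<close> is
  sesquilinear and vanishes on the diagonal of \<open>P\<close>, in particular at
  \<open>X + Y\<close> and at \<open>X + cscale \<i> Y\<close>.\<close>

lemma map_pproj_cadjoint_mult:
  assumes "X \<in> P" "Y \<in> P"
  shows "\<tau> (pproj (cadjoint X ** Y)) = pproj (cadjoint (\<tau> X) ** \<tau> Y)"
proof -
  define S where "S X Y = \<tau> (pproj (cadjoint X ** Y)) - pproj (cadjoint (\<tau> X) ** \<tau> Y)" for X Y
  have add_S: "S (X + Y) Z = S X Z + S Y Z" "S Z (X + Y) = S Z X + S Z Y" for X Y Z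
    by (simp_all add: S_def add pproj.add cadjoint_add matrix_add_ldistrib matrix_add_rdistrib)
  have scale_S: "S (cscale c X) Y = cscale (cnj c) (S X Y)" "S X (cscale c Y) = cscale c (S X Y)" for c X Y
    by (simp_all add: S_def scale pproj.scale cadjoint_cscale cscale_matrix_mult_left
        cscale_matrix_mult_right cmat.scale_right_diff_distrib)
  have 0: "S Z Z = 0" if "Z \<in> P" for Z
    using map_pproj_gram[OF that] by (simp add: S_def)
  have "S (X + Y) (X + Y) = 0" "S (X + cscale \<i> Y) (X + cscale \<i> Y) = 0"
    using assms by (intro 0 cmat.subspace_add cmat.subspace_scale subspace_P; simp)+
  then have "S X Y + S Y X = 0" "cscale \<i> (S X Y) + cscale (- \<i>) (S Y X) = 0"
    using 0 assms by (simp_all add: add_S scale_S)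
  moreover have "cscale \<i> A + cscale (- \<i>) (- A) = cscale (2 * \<i>) A" for A
    by (simp add: cscale_def vec_eq_iff)
  ultimately have "cscale (2 * \<i>) (S X Y) = 0"
    by (metis add_eq_0_iff)
  then show ?thesis by (simp add: S_def)
qed

lemma map_pproj_mult:
  assumes "X \<in> P" "Y \<in> P"
  shows "\<tau> (pproj (X ** Y)) = pproj (\<tau> X ** \<tau> Y)"
  using map_pproj_cadjoint_mult[OF cadjoint_in_P assms(2), OF assms(1)]
  by (simp add: ucp_cadjoint[OF ucp])

text \<open>By \<open>map_pproj_mult\<close> the projected product is an eigenvector for
  \<open>\<alpha> * \<beta>\<close>, so the normalised powers fix it. The remainder lies in
  \<open>N\<close> and decays, as unimodular factors preserve norms.\<close>

lemma is_peripheral_product_pproj: "is_peripheral_product \<tau> (\<lambda>X Y. pproj (X ** Y))"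
  unfolding is_peripheral_product_def
proof (intro conjI ballI allI impI)
  fix \<alpha> \<beta> :: complex and X Y
  assume "cmod \<alpha> = 1" "cmod \<beta> = 1" "X \<in> eigenspace \<tau> \<alpha>" "Y \<in> eigenspace \<tau> \<beta>"
  then have X: "\<tau> X = cscale \<alpha> X" "X \<in> P" and Y: "\<tau> Y = cscale \<beta> Y" "Y \<in> P"
    and [simp]: "cmod (\<alpha> * \<beta>) = 1"
    by (auto simp: eigenspace_def norm_mult intro: eigenvector_in_P)
  let ?c = "\<lambda>n. inverse (\<alpha> * \<beta>) ^ n"
  let ?U = "pproj (X ** Y)"
  have "\<alpha> * \<beta> \<noteq> 0" by (metis \<open>cmod (\<alpha> * \<beta>) = 1\<close> norm_zero zero_neq_one)
  have "\<tau> ?U = cscale (\<alpha> * \<beta>) ?U"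
    using map_pproj_mult[OF X(2) Y(2)]
    by (simp add: X(1) Y(1) cscale_matrix_mult_left cscale_matrix_mult_right pproj.scale mult.commute)
  then have "cscale (?c n) ((\<tau> ^^ n) ?U) = ?U" for n
    unfolding eigenvector_power[OF \<open>\<tau> ?U = cscale (\<alpha> * \<beta>) ?U\<close>] cmat.scale_scale
      power_mult_distrib[symmetric] left_inverse[OF \<open>\<alpha> * \<beta> \<noteq> 0\<close>] by simp
  moreover have "(\<lambda>n. cscale (?c n) ((\<tau> ^^ n) (X ** Y - ?U))) \<longlonglongrightarrow> 0"
  proof (rule tendsto_norm_zero_cancel)
    have "(\<lambda>n. norm ((\<tau> ^^ n) (X ** Y - ?U))) \<longlonglongrightarrow> 0"
      using diff_pproj_in_N[of "X ** Y"] by (simp add: N_def tendsto_norm_zero)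
    then show "(\<lambda>n. norm (cscale (?c n) ((\<tau> ^^ n) (X ** Y - ?U)))) \<longlonglongrightarrow> 0"
      by (simp add: norm_power norm_inverse del: inverse_mult_distrib)
  qed
  ultimately have "(\<lambda>n. cscale (?c n) ((\<tau> ^^ n) (X ** Y)) - ?U) \<longlonglongrightarrow> 0"
    by (simp add: pow_diff cmat.scale_right_diff_distrib)
  then show "(\<lambda>n. cscale (?c n) ((\<tau> ^^ n) (X ** Y))) \<longlonglongrightarrow> ?U"
    by (simp only: LIM_zero_iff)
qed (simp_all add: pproj_in_P pproj.add pproj.scale matrix_add_ldistrib matrix_add_rdistrib
    cscale_matrix_mult_left cscale_matrix_mult_right)

text \<open>Existence makes the choice in \<open>peripheral_product\<close> meaningful, and
  uniqueness determines its values on \<open>P\<close>.\<close>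

lemma peripheral_product_eq:
  assumes "X \<in> P" "Y \<in> P"
  shows "peripheral_product \<tau> X Y = pproj (X ** Y)"
proof (rule is_peripheral_product_unique[OF _ is_peripheral_product_pproj assms])
  show "is_peripheral_product \<tau> (peripheral_product \<tau>)"
    unfolding peripheral_product_def
    by (rule someI[where P = "is_peripheral_product \<tau>", OF is_peripheral_product_pproj])
qed

section \<open>Closure under multiplication and the automorphism\<close>

lemma peripherally_automorphic_iff:
  "peripherally_automorphic \<tau> \<longleftrightarrow> (\<forall>X\<in>P. \<forall>Y\<in>P. X ** Y \<in> P)"
proof -
  have fixed_iff: "pproj Z = Z \<longleftrightarrow> Z \<in> P" for Z
    by (metis pproj_ident pproj_in_P)
  have "peripherally_automorphic \<tau> \<longleftrightarrow> (\<forall>X\<in>P. \<forall>Y\<in>P. pproj (X ** Y) = X ** Y)"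
    by (simp add: peripherally_automorphic_def peripheral_product_eq)
  also have "\<dots> \<longleftrightarrow> (\<forall>X\<in>P. \<forall>Y\<in>P. X ** Y \<in> P)"
    by (simp only: fixed_iff)
  finally show ?thesis .
qed

lemma cstar_subalgebra_P:
  assumes "\<forall>X\<in>P. \<forall>Y\<in>P. X ** Y \<in> P"
  shows "cstar_subalgebra P"
  using assms by (simp add: cstar_subalgebra_def subspace_P closed_P cadjoint_in_P)

text \<open>On products that stay in \<open>P\<close> the projection is the identity, so
  \<open>map_pproj_mult\<close> becomes multiplicativity.\<close>

lemma cstar_automorphism_on_P:
  assumes "\<forall>X\<in>P. \<forall>Y\<in>P. X ** Y \<in> P"
  shows "cstar_automorphism_on P \<tau>"
proof -
  have "\<tau> (X ** Y) = \<tau> X ** \<tau> Y" if "X \<in> P" "Y \<in> P" for X Y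
  proof -
    have "X ** Y \<in> P" "\<tau> X ** \<tau> Y \<in> P" using assms that map_in_P by blast+
    then show ?thesis using map_pproj_mult[OF that] by (simp only: pproj_ident)
  qed
  then show ?thesis
    by (simp add: cstar_automorphism_on_def bij_betw_P add scale ucp_cadjoint[OF ucp])
qed

end

theorem theorem2p10:
  fixes \<tau> :: "complex ^ 'd::finite ^ 'd \<Rightarrow> complex ^ 'd ^ 'd"
  assumes "ucp \<tau>"
  shows "(peripherally_automorphic \<tau> \<longleftrightarrow>
            (\<forall>X\<in>peripheral_space \<tau>. \<forall>Y\<in>peripheral_space \<tau>. X ** Y \<in> peripheral_space \<tau>)) \<and>
         (peripherally_automorphic \<tau> \<longrightarrow>
            cstar_subalgebra (peripheral_space \<tau>) \<and>
            cstar_automorphism_on (peripheral_space \<tau>) \<tau>)"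
proof -
  interpret ucp_map \<tau> by unfold_locales (rule assms)
  show ?thesis
    using peripherally_automorphic_iff cstar_subalgebra_P cstar_automorphism_on_P by blast
qed

end
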